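(* Let $n\ge2$ and let $\mathcal G(\lambda)$ be the $n\times n$ matrix of generating functions of the algebra $\mathfrak D_n$. The braid group transformations $\beta_{1,2},\dots,\beta_{n-1,n},\beta_{n,1}$ of $\mathfrak D_n$ (given in the context) have the following matrix representation: $$\beta_{i,i+1}\,\mathcal G(\lambda)=B_{i,i+1}\,\mathcal G(\lambda)\,B_{i,i+1}^T,\qquad i=1,\dots,n-1,$$ where $B_{i,i+1}$ is the identity matrix except for its $2\times 2$ diagonal block in rows and columns $i,i+1$, which equals $\begin{pmatrix}G^{(0)}_{i,i+1}&-1\\1&0\end{pmatrix}$; and $$\beta_{n,1}\,\mathcal G(\lambda)=B_{n,1}(\lambda)\,\mathcal G(\lambda)\,\bigl(B_{n,1}(\lambda^{-1})\bigr)^T,$$ where $B_{n,1}(\lambda)$ is the $n\times n$ matrix with $(B_{n,1})_{1,n}=\lambda$, $(B_{n,1})_{n,1}=-\lambda^{-1}$, $(B_{n,1})_{n,n}=G^{(1)}_{n,1}$, $(B_{n,1})_{j,j}=1$ for $1<j<n$, and all other entries zero.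
   Context: The generators are $G^{(k)}_{i,j}$, $1\le i,j\le n$, $k\in\mathbb Z$, with $G^{(-k)}_{j,i}=G^{(k)}_{i,j}$ and $G^{(0)}_{i,i}=2$ (otherwise independent). $\mathcal G_{i,j}(\lambda)=\mathcal A^{(0)}_{i,j}+\sum_{k\ge1}G^{(k)}_{i,j}\lambda^{-k}$, where $\mathcal A^{(0)}_{i,j}=G^{(0)}_{i,j}$ for $i<j$, $1$ for $i=j$, $0$ for $i>j$. Applying $\beta$ to $\mathcal G(\lambda)$ means replacing each $G^{(k)}_{i,j}$ by its image $\widetilde G^{(k)}_{i,j}$. The transformation $\beta_{i,i+1}$, $1\le i\le n-1$ (for all $k\in\mathbb Z$; entries not determined by these formulas and the symmetry $G^{(-k)}_{j,i}=G^{(k)}_{i,j}$ are unchanged): $\widetilde G^{(k)}_{i+1,j}=G^{(k)}_{i,j}$ and $\widetilde G^{(k)}_{i,j}=G^{(k)}_{i,j}G^{(0)}_{i,i+1}-G^{(k)}_{i+1,j}$ for $j>i+1$; $\widetilde G^{(k)}_{j,i+1}=G^{(k)}_{j,i}$ and $\widetilde G^{(k)}_{j,i}=G^{(k)}_{j,i}G^{(0)}_{i,i+1}-G^{(k)}_{j,i+1}$ for $j<i$; $\widetilde G^{(k)}_{i,i}=G^{(k)}_{i,i}(G^{(0)}_{i,i+1})^2-G^{(k)}_{i,i+1}G^{(0)}_{i,i+1}-G^{(k)}_{i+1,i}G^{(0)}_{i,i+1}+G^{(k)}_{i+1,i+1}$; $\widetilde G^{(k)}_{i,i+1}=G^{(k)}_{i,i}G^{(0)}_{i,i+1}-G^{(k)}_{i+1,i}$;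 $\widetilde G^{(k)}_{i+1,i}=G^{(k)}_{i,i}G^{(0)}_{i,i+1}-G^{(k)}_{i,i+1}$; $\widetilde G^{(k)}_{i+1,i+1}=G^{(k)}_{i,i}$. The transformation $\beta_{n,1}$ (for all $k\in\mathbb Z$): for $1<j<n$, $\widetilde G^{(k)}_{1,j}=G^{(k+1)}_{n,j}$, $\widetilde G^{(k)}_{j,1}=G^{(k-1)}_{j,n}$, $\widetilde G^{(k)}_{n,j}=G^{(k)}_{n,j}G^{(1)}_{n,1}-G^{(k-1)}_{1,j}$, $\widetilde G^{(k)}_{j,n}=G^{(k)}_{j,n}G^{(1)}_{n,1}-G^{(k+1)}_{j,1}$; $\widetilde G^{(k)}_{n,n}=G^{(k)}_{n,n}(G^{(1)}_{n,1})^2-G^{(k+1)}_{n,1}G^{(1)}_{n,1}-G^{(k-1)}_{1,n}G^{(1)}_{n,1}+G^{(k)}_{1,1}$; $\widetilde G^{(k)}_{n,1}=G^{(k-1)}_{n,n}G^{(1)}_{n,1}-G^{(k-2)}_{1,n}$; $\widetilde G^{(k)}_{1,n}=G^{(k+1)}_{n,n}G^{(1)}_{n,1}-G^{(k+2)}_{n,1}$; $\widetilde G^{(k)}_{1,1}=G^{(k)}_{n,n}$; all other entries unchanged. *)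

theory Defs
  imports
    "HOL-Library.Poly_Mapping"
    "HOL-Computational_Algebra.Formal_Laurent_Series"
    "Jordan_Normal_Form.Matrix"
begin

section \<open>The algebra and its generators\<close>

text \<open>
  Commutative polynomials over a coefficient ring \<open>'k\<close> in variables labelled by triples
  \<open>(k, i, j)\<close>: a monomial is a finitely supported family of exponents, a polynomial is a finitely
  supported family of coefficients.
\<close>

type_synonym gen_index = "int \<times> nat \<times> nat"

type_synonym 'k gpoly = "(gen_index \<Rightarrow>\<^sub>0 nat) \<Rightarrow>\<^sub>0 'k"

definition gvar :: "gen_index \<Rightarrow> 'k::comm_ring_1 gpoly" where
  "gvar v = Poly_Mapping.single (Poly_Mapping.single v 1) 1"

text \<open>
  The relations \<open>G\<^sup>(\<^sup>-\<^sup>k\<^sup>)\<^sub>j\<^sub>,\<^sub>i = G\<^sup>(\<^sup>k\<^sup>)\<^sub>i\<^sub>,\<^sub>j\<close> and \<open>G\<^sup>(\<^sup>0\<^sup>)\<^sub>i\<^sub>,\<^sub>i = 2\<close> are solved by choosing one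
  representative in every orbit of \<open>(k,i,j) \<mapsto> (-k,j,i)\<close>, namely those with \<open>k > 0\<close>, or \<open>k = 0\<close> and
  \<open>i < j\<close>. The algebra is freely generated by the variables at these representatives.
\<close>

definition gen_reps :: "nat \<Rightarrow> gen_index set" where
  "gen_reps n = {(k, i, j). i \<in> {1..n} \<and> j \<in> {1..n} \<and> (k > 0 \<or> k = 0 \<and> i < j)}"

definition D_alg :: "nat \<Rightarrow> 'k::comm_ring_1 gpoly set" where
  "D_alg n = {p. \<forall>m \<in> Poly_Mapping.keys p. Poly_Mapping.keys m \<subseteq> gen_reps n}"

definition G :: "int \<Rightarrow> nat \<Rightarrow> nat \<Rightarrow> 'k::comm_ring_1 gpoly" where
  "G k i j =
    (if k > 0 then gvar (k, i, j)
     else if k < 0 then gvar (- k, j, i)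
     else if i < j then gvar (0, i, j)
     else if j < i then gvar (0, j, i)
     else 2)"

lemma G_sym: "G (- k) j i = G k i j"
  by (auto simp: G_def)

lemma G_zero_diag: "G 0 i i = 2"
  by (simp add: G_def)


section \<open>The matrix of generating functions\<close>

text \<open>
  Series in \<open>\<lambda>\<^sup>-\<^sup>1\<close> with finitely many positive powers of \<open>\<lambda>\<close> are formal Laurent series whose formal
  variable \<open>fls_X\<close> stands for \<open>\<lambda>\<^sup>-\<^sup>1\<close>.
\<close>

definition lam_pow :: "int \<Rightarrow> 'k::comm_ring_1 gpoly fls" where
  "lam_pow m = fls_X_intpow (- m)"

text \<open>Matrices are indexed from 0, the indices \<open>i, j\<close> of the generators from 1.\<close>

definition mat_from_1 :: "nat \<Rightarrow> (nat \<Rightarrow> nat \<Rightarrow> 'a) \<Rightarrow> 'a mat" where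
  "mat_from_1 n f = mat n n (\<lambda>(r, s). f (r + 1) (s + 1))"

definition A0 :: "nat \<Rightarrow> nat \<Rightarrow> 'k::comm_ring_1 gpoly" where
  "A0 i j = (if i < j then G 0 i j else if i = j then 1 else 0)"

definition Gser :: "nat \<Rightarrow> nat \<Rightarrow> 'k::comm_ring_1 gpoly fls" where
  "Gser i j = fps_to_fls (Abs_fps (\<lambda>k. if k = 0 then A0 i j else G (int k) i j))"

definition Gmat :: "nat \<Rightarrow> 'k::comm_ring_1 gpoly fls mat" where
  "Gmat n = mat_from_1 n Gser"


section \<open>The braid group transformations\<close>

text \<open>The algebra endomorphism sending each variable \<open>v\<close> to \<open>f v\<close>.\<close>

definition gsubst :: "(gen_index \<Rightarrow> 'k gpoly) \<Rightarrow> 'k gpoly \<Rightarrow> 'k::comm_ring_1 gpoly" where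
  "gsubst f p =
    (\<Sum>m \<in> Poly_Mapping.keys p.
       Poly_Mapping.single 0 (Poly_Mapping.lookup p m) *
       (\<Prod>v \<in> Poly_Mapping.keys m. f v ^ Poly_Mapping.lookup m v))"

text \<open>
  \<open>beta_gen i k a b\<close> is the image of \<open>G k a b\<close> under \<open>\<beta>\<^sub>i\<^sub>,\<^sub>i\<^sub>+\<^sub>1\<close>. The formulas for row \<open>i\<close> and row
  \<open>i + 1\<close> are originally given for columns beyond \<open>i + 1\<close>, those for column \<open>i\<close> and column \<open>i + 1\<close>
  for rows before \<open>i\<close>; the symmetry \<open>G_sym\<close> extends them in the same shape to the remaining
  positions.
\<close>

definition beta_gen :: "nat \<Rightarrow> int \<Rightarrow> nat \<Rightarrow> nat \<Rightarrow> 'k::comm_ring_1 gpoly" where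
  "beta_gen i k a b =
    (let g = G 0 i (i + 1) in
     if a = i \<and> b = i then
       G k i i * g\<^sup>2 - G k i (i + 1) * g - G k (i + 1) i * g + G k (i + 1) (i + 1)
     else if a = i \<and> b = i + 1 then G k i i * g - G k (i + 1) i
     else if a = i + 1 \<and> b = i then G k i i * g - G k i (i + 1)
     else if a = i + 1 \<and> b = i + 1 then G k i i
     else if a = i + 1 then G k i b
     else if a = i then G k i b * g - G k (i + 1) b
     else if b = i + 1 then G k a i
     else if b = i then G k a i * g - G k a (i + 1)
     else G k a b)"

text \<open>\<open>beta_n1_gen n k a b\<close> is the image of \<open>G k a b\<close> under \<open>\<beta>\<^sub>n\<^sub>,\<^sub>1\<close>.\<close>

definition beta_n1_gen :: "nat \<Rightarrow> int \<Rightarrow> nat \<Rightarrow> nat \<Rightarrow> 'k::comm_ring_1 gpoly" where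
  "beta_n1_gen n k a b =
    (let g = G 1 n 1 in
     if a = 1 \<and> 1 < b \<and> b < n then G (k + 1) n b
     else if b = 1 \<and> 1 < a \<and> a < n then G (k - 1) a n
     else if a = n \<and> 1 < b \<and> b < n then G k n b * g - G (k - 1) 1 b
     else if b = n \<and> 1 < a \<and> a < n then G k a n * g - G (k + 1) a 1
     else if a = n \<and> b = n then
       G k n n * g\<^sup>2 - G (k + 1) n 1 * g - G (k - 1) 1 n * g + G k 1 1
     else if a = n \<and> b = 1 then G (k - 1) n n * g - G (k - 2) 1 n
     else if a = 1 \<and> b = n then G (k + 1) n n * g - G (k + 2) n 1
     else if a = 1 \<and> b = 1 then G k n n
     else G k a b)"

definition beta :: "nat \<Rightarrow> 'k gpoly \<Rightarrow> 'k::comm_ring_1 gpoly" where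
  "beta i = gsubst (\<lambda>(k, a, b). beta_gen i k a b)"

definition beta_n1 :: "nat \<Rightarrow> 'k gpoly \<Rightarrow> 'k::comm_ring_1 gpoly" where
  "beta_n1 n = gsubst (\<lambda>(k, a, b). beta_n1_gen n k a b)"

definition map_coeffs :: "('a \<Rightarrow> 'b) \<Rightarrow> 'a::zero fls \<Rightarrow> 'b::zero fls" where
  "map_coeffs f F = Abs_fls (\<lambda>m. f (fls_nth F m))"

text \<open>
  The two endomorphisms are defined by their values on the chosen representatives only; the
  following facts say that they take the prescribed values on all \<open>G k a b\<close>.
\<close>

lemma gsubst_gvar: "gsubst f (gvar v) = f v"
  by (simp add: gsubst_def gvar_def)

lemma gsubst_one: "gsubst f 1 = 1"
  by (simp add: gsubst_def)

lemma gsubst_two: "gsubst f (2 :: 'k::comm_ring_1 gpoly) = 2"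
proof -
  have const: "gsubst f (Poly_Mapping.single 0 c) = Poly_Mapping.single 0 c" for c :: 'k
    by (cases "c = 0") (simp_all add: gsubst_def)
  show ?thesis
    using const[of 2] by simp
qed

lemma G_shift_sym:
  "G (- k + 1) x y = G (k - 1) y x" "G (- k - 1) x y = G (k + 1) y x"
  "G (- k + 2) x y = G (k - 2) y x" "G (- k - 2) x y = G (k + 2) y x"
  "G 0 (Suc x) x = G 0 x (Suc x)" "G (- 1) x y = G 1 y x"
  by (auto simp: G_def intro!: arg_cong[of _ _ gvar])

lemma beta_gen_sym: "beta_gen i (- k) b a = beta_gen i k a b"
  by (cases "a = i"; cases "a = i + 1"; cases "b = i"; cases "b = i + 1")
    (simp_all add: beta_gen_def Let_def G_sym G_shift_sym)

lemma beta_n1_gen_sym: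
  assumes n: "n \<ge> 2"
  shows "beta_n1_gen n (- k) b a = beta_n1_gen n k a b"
proof -
  have cs: "x = 1 \<and> x \<noteq> n \<and> \<not> (1 < x \<and> x < n) \<or> x \<noteq> 1 \<and> x = n \<and> \<not> (1 < x \<and> x < n) \<or>
      x \<noteq> 1 \<and> x \<noteq> n \<and> (1 < x \<and> x < n) \<or> x \<noteq> 1 \<and> x \<noteq> n \<and> \<not> (1 < x \<and> x < n)" for x
    using n by linarith
  show ?thesis
    using cs[of a] cs[of b] unfolding beta_n1_gen_def Let_def G_shift_sym G_sym
    by (elim disjE conjE; simp only: simp_thms if_True if_False; simp add: algebra_simps)
qed

lemma beta_gen_diag: "beta_gen i 0 a a = 2"
  by (simp add: beta_gen_def Let_def G_zero_diag G_shift_sym power2_eq_square algebra_simps)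

lemma beta_n1_gen_diag:
  assumes "n \<ge> 2"
  shows "beta_n1_gen n 0 a a = 2"
  using assms
  by (auto simp: beta_n1_gen_def Let_def G_zero_diag G_shift_sym power2_eq_square algebra_simps)

lemma gsubst_G:
  assumes "\<And>k a b. h (- k) b a = h k a b" and "\<And>a. h 0 a a = 2"
  shows "gsubst (\<lambda>(k, a, b). h k a b) (G k a b) = h k a b"
  using assms(1)[of k b a] assms(1)[of 0 b a] assms(2)[of a]
  by (auto simp: G_def gsubst_gvar gsubst_two not_less)

lemma beta_G: "beta i (G k a b) = beta_gen i k a b"
  unfolding beta_def by (rule gsubst_G) (simp_all add: beta_gen_sym beta_gen_diag)

lemma beta_n1_G: "n \<ge> 2 \<Longrightarrow> beta_n1 n (G k a b) = beta_n1_gen n k a b"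
  unfolding beta_n1_def by (rule gsubst_G) (simp_all add: beta_n1_gen_sym beta_n1_gen_diag)


text \<open>The transformations restrict to \<open>D_alg n\<close>.\<close>

lemma D_alg_single: "Poly_Mapping.keys m \<subseteq> gen_reps n \<Longrightarrow> Poly_Mapping.single m c \<in> D_alg n"
  by (simp add: D_alg_def)

lemma D_alg_0: "0 \<in> D_alg n"
  and D_alg_1: "1 \<in> D_alg n"
  by (simp_all add: D_alg_def)

lemma D_alg_add: "p \<in> D_alg n \<Longrightarrow> q \<in> D_alg n \<Longrightarrow> p + q \<in> D_alg n"
  using Poly_Mapping.keys_add[of p q] by (fastforce simp: D_alg_def)

lemma D_alg_uminus: "p \<in> D_alg n \<Longrightarrow> - p \<in> D_alg n"
proof -
  have "Poly_Mapping.keys (- p) \<subseteq> Poly_Mapping.keys p"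
    by (auto simp: in_keys_iff)
  then show "p \<in> D_alg n \<Longrightarrow> - p \<in> D_alg n"
    by (auto simp: D_alg_def)
qed

lemma D_alg_diff: "p \<in> D_alg n \<Longrightarrow> q \<in> D_alg n \<Longrightarrow> p - q \<in> D_alg n"
  using D_alg_add[of p n "- q"] D_alg_uminus[of q n] by simp

lemma D_alg_mult:
  assumes "p \<in> D_alg n" "q \<in> D_alg n" shows "p * q \<in> D_alg n"
proof -
  have "Poly_Mapping.keys m \<subseteq> gen_reps n" if m: "m \<in> Poly_Mapping.keys (p * q)" for m
  proof -
    obtain u v where uv: "u \<in> Poly_Mapping.keys p" "v \<in> Poly_Mapping.keys q" "m = u + v"
      using m keys_mult[of p q] by blast
    show ?thesis
      using assms uv Poly_Mapping.keys_add[of u v] unfolding D_alg_def by blast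
  qed
  then show ?thesis by (simp add: D_alg_def)
qed

lemma D_alg_power: "p \<in> D_alg n \<Longrightarrow> p ^ e \<in> D_alg n"
  by (induction e) (simp_all add: D_alg_1 D_alg_mult)

lemma G_in_D_alg: "i \<in> {1..n} \<Longrightarrow> j \<in> {1..n} \<Longrightarrow> G k i j \<in> D_alg n"
proof -
  have "1 + 1 \<in> D_alg n" by (intro D_alg_add D_alg_1)
  then show "i \<in> {1..n} \<Longrightarrow> j \<in> {1..n} \<Longrightarrow> G k i j \<in> D_alg n"
    by (auto simp: G_def gvar_def gen_reps_def intro!: D_alg_single)
qed

lemma gsubst_in_D_alg:
  assumes "p \<in> D_alg n" "\<And>v. v \<in> gen_reps n \<Longrightarrow> f v \<in> D_alg n"
  shows "gsubst f p \<in> D_alg n"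
proof -
  have sum: "(\<And>x. x \<in> A \<Longrightarrow> h x \<in> D_alg n) \<Longrightarrow> sum h A \<in> D_alg n" for A and h :: "_ \<Rightarrow> 'a gpoly"
    by (induction A rule: infinite_finite_induct) (simp_all add: D_alg_0 D_alg_add)
  have prod: "(\<And>x. x \<in> A \<Longrightarrow> h x \<in> D_alg n) \<Longrightarrow> prod h A \<in> D_alg n" for A and h :: "_ \<Rightarrow> 'a gpoly"
    by (induction A rule: infinite_finite_induct) (simp_all add: D_alg_1 D_alg_mult)
  have "f v \<in> D_alg n" if "m \<in> Poly_Mapping.keys p" "v \<in> Poly_Mapping.keys m" for m v
    using assms that unfolding D_alg_def by blast
  then show ?thesis
    unfolding gsubst_def
    by (intro sum D_alg_mult D_alg_single prod D_alg_power) auto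
qed

lemma if_in: "x \<in> S \<Longrightarrow> y \<in> S \<Longrightarrow> (if P then x else y) \<in> S"
  by simp

lemma beta_in_D_alg:
  assumes "i \<in> {1..n - 1}" "p \<in> D_alg n"
  shows "beta i p \<in> D_alg n"
proof -
  have "beta_gen i k a b \<in> D_alg n" if "a \<in> {1..n}" "b \<in> {1..n}" for k a b
    unfolding beta_gen_def Let_def
    by (intro if_in D_alg_add D_alg_diff D_alg_mult D_alg_power G_in_D_alg)
      (use assms(1) that in auto)
  then show ?thesis
    unfolding beta_def by (intro gsubst_in_D_alg assms(2)) (auto simp: gen_reps_def)
qed

lemma beta_n1_in_D_alg:
  assumes "n \<ge> 2" "p \<in> D_alg n"
  shows "beta_n1 n p \<in> D_alg n"
proof -
  have "beta_n1_gen n k a b \<in> D_alg n" if "a \<in> {1..n}" "b \<in> {1..n}" for k a b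
    unfolding beta_n1_gen_def Let_def
    by (intro if_in D_alg_add D_alg_diff D_alg_mult D_alg_power G_in_D_alg)
      (use assms(1) that in auto)
  then show ?thesis
    unfolding beta_n1_def by (intro gsubst_in_D_alg assms(2)) (auto simp: gen_reps_def)
qed


section \<open>The matrices of the representation\<close>

definition B_mat :: "nat \<Rightarrow> nat \<Rightarrow> 'k::comm_ring_1 gpoly fls mat" where
  "B_mat n i = mat_from_1 n (\<lambda>a b.
     if a = i \<and> b = i then fls_const (G 0 i (i + 1))
     else if a = i \<and> b = i + 1 then - 1
     else if a = i + 1 \<and> b = i then 1
     else if a = i + 1 \<and> b = i + 1 then 0
     else if a = b then 1 else 0)"

text \<open>\<open>B_n1_mat n e\<close> is \<open>B\<^sub>n\<^sub>,\<^sub>1(\<lambda>\<^sup>e)\<close>; only \<open>e = 1\<close> and \<open>e = -1\<close> are needed.\<close>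

definition B_n1_mat :: "nat \<Rightarrow> int \<Rightarrow> 'k::comm_ring_1 gpoly fls mat" where
  "B_n1_mat n e = mat_from_1 n (\<lambda>a b.
     if a = 1 \<and> b = n then lam_pow e
     else if a = n \<and> b = 1 then - lam_pow (- e)
     else if a = n \<and> b = n then fls_const (G 1 n 1)
     else if a = b \<and> 1 < a \<and> a < n then 1 else 0)"

end

theory Submission
  imports Defs
begin

text \<open>
  Consider the two-sided series \<open>S(\<lambda>) = \<Sum>\<^sub>k G\<^sup>(\<^sup>k\<^sup>) \<lambda>\<^sup>-\<^sup>k\<close> over all integers \<open>k\<close>. The formulas for the braid
  transformations say precisely that \<open>S\<close> gets multiplied by \<open>B(\<lambda>)\<close> on the left and by
  \<open>B(\<lambda>\<^sup>-\<^sup>1)\<^sup>T\<close> on the right. The matrix \<open>\<G>\<close> is one half of \<open>S\<close>: because of the symmetry of the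
  generators, \<open>S(\<lambda>) = \<G>(\<lambda>) + \<G>(\<lambda>\<^sup>-\<^sup>1)\<^sup>T\<close>. So only the coefficients near the cut between the two halves
  can go wrong, and there the claim rests on the constant term of \<open>\<G>\<close> being upper triangular with
  unit diagonal. For \<open>\<beta>\<^sub>i\<^sub>,\<^sub>i\<^sub>+\<^sub>1\<close> the factors are constant and just the coefficient of \<open>\<lambda>\<^sup>0\<close> is
  special. For \<open>\<beta>\<^sub>n\<^sub>,\<^sub>1\<close> the powers of \<open>\<lambda>\<close> in the factors carry terms across the cut. Those that would
  land on positive powers of \<open>\<lambda>\<close> vanish by triangularity, except in the corner \<open>(1, n)\<close>,
  where the coefficient of \<open>\<lambda>\<close> is \<open>G\<^sup>(\<^sup>1\<^sup>)\<^sub>n\<^sub>,\<^sub>1 - G\<^sup>(\<^sup>1\<^sup>)\<^sub>n\<^sub>,\<^sub>1 = 0\<close>.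

  Since every row of \<open>B\<close> has at most two nonzero entries, the double sum for an entry of the product
  collapses (\<open>B_entry_sum\<close>, \<open>B_n1_entry_sum\<close>) to at most four shifted entries of \<open>\<G>\<close>. What
  remains is a comparison of coefficients entry by entry (\<open>beta_Gser\<close>, \<open>beta_n1_Gser\<close>).
\<close>

section \<open>Coefficients of the generating functions\<close>

lemma Gser_nth:
  "fls_nth (Gser a b) m = (if m < 0 then 0 else if m = 0 then A0 a b else G m a b)"
  by (simp add: Gser_def)

lemma gsubst_zero: "gsubst f 0 = 0"
  by (simp add: gsubst_def)

text \<open>
  Unless \<open>f\<close> preserves zero, applying it to the coefficients leaves infinitely many nonzero
  ones on the polar side, and \<open>Abs_fls\<close> is then unspecified.
\<close>

lemma map_coeffs_nth:
  assumes "f 0 = 0"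
  shows "fls_nth (map_coeffs f F) m = f (fls_nth F m)"
proof -
  have "fls_nth F m = 0" if "m < fls_subdegree F" for m
    using that by simp
  then show ?thesis
    unfolding map_coeffs_def
    by (subst nth_Abs_fls_lower_bound[of "fls_subdegree F"]) (simp_all add: assms)
qed

lemma lam_pow_times_nth: "fls_nth (lam_pow e * F) m = fls_nth F (m + e)"
  by (simp only: lam_pow_def fls_X_intpow_times_conv_shift) simp

lemma beta_A0:
  "beta i (A0 a b) = (if a < b then beta_gen i 0 a b else if a = b then 1 else 0)"
  by (simp add: A0_def beta_G) (simp add: beta_def gsubst_zero gsubst_one)

lemma beta_n1_A0:
  assumes "n \<ge> 2"
  shows "beta_n1 n (A0 a b) = (if a < b then beta_n1_gen n 0 a b else if a = b then 1 else 0)"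
  using assms by (simp add: A0_def beta_n1_G) (simp add: beta_n1_def gsubst_zero gsubst_one)

lemma map_coeffs_beta_Gser_nth:
  "fls_nth (map_coeffs (beta i) (Gser a b)) m =
    (if m < 0 then 0
     else if m = 0 then if a < b then beta_gen i 0 a b else if a = b then 1 else 0
     else beta_gen i m a b)"
  using beta_A0[of i a b]
  by (subst map_coeffs_nth) (auto simp: beta_def gsubst_zero Gser_nth beta_G[unfolded beta_def])

lemma map_coeffs_beta_n1_Gser_nth:
  assumes "n \<ge> 2"
  shows "fls_nth (map_coeffs (beta_n1 n) (Gser a b)) m =
    (if m < 0 then 0
     else if m = 0 then if a < b then beta_n1_gen n 0 a b else if a = b then 1 else 0
     else beta_n1_gen n m a b)"
  using beta_n1_A0[OF assms, of a b]
  by (subst map_coeffs_nth)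
    (auto simp: beta_n1_def gsubst_zero Gser_nth beta_n1_G[OF assms, unfolded beta_n1_def])


section \<open>Congruence transforms by sparse matrices\<close>

lemma mat_from_1_cong:
  assumes "\<And>a b. a \<in> {1..n} \<Longrightarrow> b \<in> {1..n} \<Longrightarrow> f a b = g a b"
  shows "mat_from_1 n f = mat_from_1 n g"
  unfolding mat_from_1_def by (rule eq_matI) (simp_all add: assms)

lemma map_mat_mat_from_1: "map_mat h (mat_from_1 n f) = mat_from_1 n (\<lambda>a b. h (f a b))"
  unfolding mat_from_1_def by (rule eq_matI) simp_all

lemma mat_from_1_congruence:
  "mat_from_1 n X * mat_from_1 n Y * transpose_mat (mat_from_1 n Z) =
    mat_from_1 n (\<lambda>a b. \<Sum>q\<in>{1..n}. Z b q * (\<Sum>p\<in>{1..n}. X a p * Y p q))"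
  for X Y Z :: "nat \<Rightarrow> nat \<Rightarrow> 'a::comm_ring_1"
proof -
  have shift: "sum f {1..n} = (\<Sum>p<n. f (Suc p))" for f :: "nat \<Rightarrow> 'a"
    by (simp add: sum.atLeast1_atMost_eq)
  show ?thesis
    unfolding mat_from_1_def shift
    by (rule eq_matI) (simp_all add: scalar_prod_def lessThan_atLeast0 mult.commute[of _ "Z _ _"])
qed

definition B_entry :: "nat \<Rightarrow> nat \<Rightarrow> nat \<Rightarrow> 'k::comm_ring_1 gpoly fls" where
  "B_entry i a b =
    (if a = i \<and> b = i then fls_const (G 0 i (i + 1))
     else if a = i \<and> b = i + 1 then - 1
     else if a = i + 1 \<and> b = i then 1
     else if a = i + 1 \<and> b = i + 1 then 0
     else if a = b then 1 else 0)"

definition B_n1_entry :: "nat \<Rightarrow> int \<Rightarrow> nat \<Rightarrow> nat \<Rightarrow> 'k::comm_ring_1 gpoly fls" where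
  "B_n1_entry n e a b =
    (if a = 1 \<and> b = n then lam_pow e
     else if a = n \<and> b = 1 then - lam_pow (- e)
     else if a = n \<and> b = n then fls_const (G 1 n 1)
     else if a = b \<and> 1 < a \<and> a < n then 1 else 0)"

text \<open>
  An entry of the product of \<open>B\<close> with a vector \<open>f\<close>, with the sum over the at most two nonzero
  entries of a row written out. The column side of \<open>B \<G> B\<^sup>T\<close> takes the same form, so nesting
  two of these gives an entry of the whole product.
\<close>

definition B_row_times :: "nat \<Rightarrow> nat \<Rightarrow> (nat \<Rightarrow> 'k::comm_ring_1 gpoly fls) \<Rightarrow> 'k gpoly fls" where
  "B_row_times i a f =
    (if a = i then fls_const (G 0 i (i + 1)) * f i - f (i + 1)
     else if a = i + 1 then f i else f a)"

definition B_n1_row_times ::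
    "nat \<Rightarrow> int \<Rightarrow> nat \<Rightarrow> (nat \<Rightarrow> 'k::comm_ring_1 gpoly fls) \<Rightarrow> 'k gpoly fls" where
  "B_n1_row_times n e a f =
    (if a = 1 then lam_pow e * f n
     else if a = n then fls_const (G 1 n 1) * f n - lam_pow (- e) * f 1
     else f a)"

lemma B_entry_sum:
  assumes "i \<in> {1..n - 1}" "a \<in> {1..n}"
  shows "(\<Sum>p\<in>{1..n}. B_entry i a p * f p) = B_row_times i a f"
proof -
  have "(\<Sum>p\<in>{1..n}. B_entry i a p * f p) =
    (\<Sum>p\<in>{1..n}. (if p = i then B_entry i a i * f i else 0)
      + (if p = i + 1 then B_entry i a (i + 1) * f (i + 1) else 0)
      + (if p = a then if a = i \<or> a = i + 1 then 0 else f a else 0))"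
    by (rule sum.cong) (auto simp: B_entry_def)
  also have "\<dots> = B_entry i a i * f i + B_entry i a (i + 1) * f (i + 1)
      + (if a = i \<or> a = i + 1 then 0 else f a)"
    using assms by (auto simp add: sum.distrib)
  finally show ?thesis
    by (auto simp: B_entry_def B_row_times_def)
qed

lemma B_n1_entry_sum:
  assumes "n \<ge> 2" "a \<in> {1..n}"
  shows "(\<Sum>p\<in>{1..n}. B_n1_entry n e a p * f p) = B_n1_row_times n e a f"
proof -
  have "(\<Sum>p\<in>{1..n}. B_n1_entry n e a p * f p) =
    (\<Sum>p\<in>{1..n}. (if p = 1 then B_n1_entry n e a 1 * f 1 else 0)
      + (if p = n then B_n1_entry n e a n * f n else 0)
      + (if p = a then if a = 1 \<or> a = n then 0 else f a else 0))"
    using assms by (intro sum.cong) (auto simp: B_n1_entry_def)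
  also have "\<dots> = B_n1_entry n e a 1 * f 1 + B_n1_entry n e a n * f n
      + (if a = 1 \<or> a = n then 0 else f a)"
    using assms by (auto simp add: sum.distrib)
  finally show ?thesis
    using assms by (auto simp: B_n1_entry_def B_n1_row_times_def)
qed


section \<open>Comparison of coefficients\<close>

text \<open>
  For nonzero powers of \<open>\<lambda>\<close> both sides are the same expression in the generators. In the constant
  coefficient the transformation uses \<open>G\<^sup>(\<^sup>0\<^sup>)\<^sub>i\<^sub>,\<^sub>i = 2\<close> where \<open>\<G>\<close> has the diagonal entry \<open>1\<close>, and
  \<open>G\<^sup>(\<^sup>0\<^sup>)\<^sub>i\<^sub>+\<^sub>1\<^sub>,\<^sub>i = G\<^sup>(\<^sup>0\<^sup>)\<^sub>i\<^sub>,\<^sub>i\<^sub>+\<^sub>1\<close> where \<open>\<G>\<close> has \<open>0\<close>. With \<open>g = G\<^sup>(\<^sup>0\<^sup>)\<^sub>i\<^sub>,\<^sub>i\<^sub>+\<^sub>1\<close> the two changes cancel: in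
  position \<open>(i, i + 1)\<close> the image \<open>2 g - g\<close> meets \<open>1 g - 0\<close>.
\<close>

lemma beta_Gser:
  "map_coeffs (beta i) (Gser a b) = B_row_times i b (\<lambda>q. B_row_times i a (\<lambda>p. Gser p q))"
proof (rule fls_eqI)
  fix m :: int
  show "fls_nth (map_coeffs (beta i) (Gser a b)) m =
    fls_nth (B_row_times i b (\<lambda>q. B_row_times i a (\<lambda>p. Gser p q))) m"
    unfolding map_coeffs_beta_Gser_nth
    by (cases "a = i"; cases "a = i + 1"; cases "b = i"; cases "b = i + 1";
        simp add: B_row_times_def beta_gen_def Let_def Gser_nth A0_def G_zero_diag G_shift_sym
          power2_eq_square;
        (simp add: algebra_simps)?)
qed

text \<open>
  The rows \<open>1\<close> and \<open>n\<close> of \<open>B\<^sub>n\<^sub>,\<^sub>1(\<lambda>)\<close> and the columns \<open>1\<close> and \<open>n\<close> of \<open>B\<^sub>n\<^sub>,\<^sub>1(\<lambda>\<^sup>-\<^sup>1)\<^sup>T\<close> shift the coefficient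
  index by at most one each, so an entry of the product reads coefficients of \<open>\<G>\<close> up to two places away.
  When the index is outside \<open>-2, \<dots>, 2\<close>, all of them lie on the same side of the cut at \<open>0\<close>. In between,
  write \<open>g = G\<^sup>(\<^sup>1\<^sup>)\<^sub>n\<^sub>,\<^sub>1 = G\<^sup>(\<^sup>-\<^sup>1\<^sup>)\<^sub>1\<^sub>,\<^sub>n\<close>. In position \<open>(n, 1)\<close> and at \<open>\<lambda>\<^sup>-\<^sup>1\<close> the image \<open>2 g - g\<close> meets the
  product \<open>1 g - 0\<close>. In position \<open>(n, n)\<close> the constant coefficient of the product is
  \<open>g\<^sup>2 - g\<^sup>2 + 1 = 1\<close>.
\<close>

lemma beta_n1_Gser:
  assumes "n \<ge> 2" "a \<in> {1..n}" "b \<in> {1..n}"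
  shows "map_coeffs (beta_n1 n) (Gser a b) =
    B_n1_row_times n (- 1) b (\<lambda>q. B_n1_row_times n 1 a (\<lambda>p. Gser p q))"
proof (rule fls_eqI)
  fix m :: int
  \<comment> \<open>Each case decides every comparison of an index with \<open>1\<close> and \<open>n\<close>, so the nested conditionals
    collapse before any algebra is done; for \<open>n = 2\<close> the last case is empty.\<close>
  have position: "x = 1 \<and> x \<noteq> n \<and> \<not> (1 < x \<and> x < n) \<or>
      x \<noteq> 1 \<and> x = n \<and> \<not> (1 < x \<and> x < n) \<or>
      x \<noteq> 1 \<and> x \<noteq> n \<and> (1 < x \<and> x < n)" if "x \<in> {1..n}" for x
    using that assms(1) by auto
  have m: "m < - 2 \<or> m = - 2 \<or> m = - 1 \<or> m = 0 \<or> m = 1 \<or> m = 2 \<or> m > 2"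
    by linarith
  show "fls_nth (map_coeffs (beta_n1 n) (Gser a b)) m =
    fls_nth (B_n1_row_times n (- 1) b (\<lambda>q. B_n1_row_times n 1 a (\<lambda>p. Gser p q))) m"
    unfolding map_coeffs_beta_n1_Gser_nth[OF assms(1)] beta_n1_gen_def B_n1_row_times_def Let_def
    using m position[OF assms(2)] position[OF assms(3)] assms(1)
    by (elim disjE conjE; simp only: simp_thms if_True if_False;
        simp add: Gser_nth A0_def lam_pow_times_nth G_zero_diag G_shift_sym power2_eq_square;
        (simp add: algebra_simps)?)
qed


section \<open>The matrix representation\<close>

theorem proposition6p6:
  fixes n :: nat
  assumes "n \<ge> 2"
  shows "(\<forall>i \<in> {1..n - 1}.
      map_mat (map_coeffs (beta i)) (Gmat n :: 'k::comm_ring_1 gpoly fls mat)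
          = B_mat n i * Gmat n * transpose_mat (B_mat n i)) \<and>
      map_mat (map_coeffs (beta_n1 n)) (Gmat n :: 'k::comm_ring_1 gpoly fls mat)
          = B_n1_mat n 1 * Gmat n * transpose_mat (B_n1_mat n (- 1))"
proof (intro conjI ballI)
  fix i assume i: "i \<in> {1..n - 1}"
  have B: "B_mat n i = mat_from_1 n (B_entry i :: _ \<Rightarrow> _ \<Rightarrow> 'k gpoly fls)"
    unfolding B_mat_def B_entry_def ..
  show "map_mat (map_coeffs (beta i)) (Gmat n :: 'k gpoly fls mat) =
      B_mat n i * Gmat n * transpose_mat (B_mat n i)"
    unfolding B Gmat_def mat_from_1_congruence map_mat_mat_from_1
    by (rule mat_from_1_cong)
      (simp only: beta_Gser B_entry_sum[OF i])
next
  have B: "B_n1_mat n e = mat_from_1 n (B_n1_entry n e :: _ \<Rightarrow> _ \<Rightarrow> 'k gpoly fls)" for e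
    unfolding B_n1_mat_def B_n1_entry_def ..
  show "map_mat (map_coeffs (beta_n1 n)) (Gmat n :: 'k gpoly fls mat) =
      B_n1_mat n 1 * Gmat n * transpose_mat (B_n1_mat n (- 1))"
    unfolding B Gmat_def mat_from_1_congruence map_mat_mat_from_1
    by (rule mat_from_1_cong)
      (simp only: beta_n1_Gser[OF assms] B_n1_entry_sum[OF assms])
qed

end
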